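(* Let the $3$-stage ($s=3$) Lobatto IIIA/IIIB pair be applied to the partitioned linear port-Hamiltonian system $$\begin{bmatrix}\dot{\mathbf{q}}(t)\\ \dot{\mathbf{p}}(t)\end{bmatrix}=\begin{bmatrix}\mathbf{0}&\mathbf{I}\\-\mathbf{I}&\mathbf{0}\end{bmatrix}\begin{bmatrix}\mathbf{Q}\mathbf{q}(t)\\ \mathbf{P}\mathbf{p}(t)\end{bmatrix}+\begin{bmatrix}\mathbf{0}\\ \mathbf{G}\end{bmatrix}\mathbf{u}(t),\qquad \mathbf{y}(t)=\begin{bmatrix}\mathbf{0}&\mathbf{G}^T\end{bmatrix}\begin{bmatrix}\mathbf{Q}\mathbf{q}(t)\\ \mathbf{P}\mathbf{p}(t)\end{bmatrix},$$ with $\mathbf{q},\mathbf{p}\in\mathbb{R}^n$, $\mathbf{u}\in\mathbb{R}^m$, on a step of size $h$ starting at time $t_0^k$ from the exact values $\mathbf{q}_0^k=\mathbf{q}(t_0^k)$, $\mathbf{p}_0^k=\mathbf{p}(t_0^k)$. Let $\Delta\tilde H^k$, $\Delta\bar H^k$, $\Delta H^k$ be the approximate supplied energy, the numerical stored-energy increment and the exact energy increment on this step, as defined in the context. Then the error between $\Delta\tilde H^k$ and $\Delta\bar H^k$, and consequently the error between $\Delta\tilde H^k$ and $\Delta H^k$, has order $o(h^{2s-2})=o(h^4)$, in the sense of the context: there is a constant $C>0$ such that $|\Delta\tilde H^k-\Delta\bar H^k|\le Ch^5$ and $|\Delta\tilde H^k-\Delta H^k|\le Ch^5$ for all sufficiently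 small $h>0$.
   Context: $\mathbf{Q}=\mathbf{Q}^T>0$ and $\mathbf{P}=\mathbf{P}^T>0$ are constant $n\times n$ matrices (stiffness matrix and inverse mass matrix), $\mathbf{G}\in\mathbb{R}^{n\times m}$ is constant, and the input $\mathbf{u}(t)$ is a sufficiently smooth function of time. The Hamiltonian is $H(\mathbf{q},\mathbf{p})=\frac12\mathbf{q}^T\mathbf{Q}\mathbf{q}+\frac12\mathbf{p}^T\mathbf{P}\mathbf{p}$. Scheme (3-stage Lobatto pair): collocation points $c_1=0$, $c_2=\frac12$, $c_3=1$; weights $b=\hat b=(\frac16,\frac23,\frac16)$; coefficients $$(a_{ij})=\begin{bmatrix}0&0&0\\ \frac5{24}&\frac13&-\frac1{24}\\ \frac16&\frac23&\frac16\end{bmatrix}\ (\text{IIIA, for }\mathbf{q}),\qquad(\hat a_{ij})=\begin{bmatrix}\frac16&-\frac16&0\\ \frac16&\frac13&0\\ \frac16&\frac56&0\end{bmatrix}\ (\text{IIIB, for }\mathbf{p}).$$ For $i=1,2,3$: $$\mathbf{q}_i^k=\mathbf{q}_0^k-h\sum_{j=1}^3a_{ij}\mathbf{f}_{q,j}^k,\quad \mathbf{p}_i^k=\mathbf{p}_0^k-h\sum_{j=1}^3\hat a_{ij}\mathbf{f}_{p,j}^k,\quad \mathbf{q}_4^k=\mathbf{q}_0^k-h\sum_{j=1}^3b_j\mathbf{f}_{q,j}^k,\quad \mathbf{p}_4^k=\mathbf{p}_0^k-h\sum_{j=1}^3\hat b_j\mathbf{f}_{p,j}^k,$$ with $\mathbf{e}_{q,i}^k=\mathbf{Q}\mathbf{q}_i^k$,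 $\mathbf{e}_{p,i}^k=\mathbf{P}\mathbf{p}_i^k$, $\mathbf{u}_i^k=\mathbf{u}(t_0^k+c_ih)$, $\mathbf{f}_{q,j}^k=-\mathbf{e}_{p,j}^k$, $\mathbf{f}_{p,j}^k=\mathbf{e}_{q,j}^k-\mathbf{G}\mathbf{u}_j^k$. The index $4=s+1$ denotes the end of the step. Stacked vectors: $\mathbf{e}_q^k,\mathbf{e}_p^k,\mathbf{f}_q^k,\mathbf{f}_p^k\in\mathbb{R}^{3n}$ collect the respective stage vectors for $i=1,2,3$. With the Lagrange polynomials $\ell_i(\tau)=\prod_{j\ne i}\frac{\tau-c_j}{c_i-c_j}$ and $m_{ij}=\int_0^1\ell_i(\sigma)\ell_j(\sigma)\,d\sigma$, $$\mathbf{M}=(m_{ij})\otimes\mathbf{I}_n=\begin{bmatrix}\frac2{15}&\frac1{15}&-\frac1{30}\\ \frac1{15}&\frac8{15}&\frac1{15}\\-\frac1{30}&\frac1{15}&\frac2{15}\end{bmatrix}\otimes\mathbf{I}_n .$$ Energies: $\Delta\tilde H^k=-h(\mathbf{e}_q^k)^T\mathbf{M}\mathbf{f}_q^k-h(\mathbf{e}_p^k)^T\mathbf{M}\mathbf{f}_p^k$ (approximate supplied energy); $\Delta\bar H^k=H(\mathbf{q}_4^k,\mathbf{p}_4^k)-H(\mathbf{q}_0^k,\mathbf{p}_0^k)$ (numerical stored-energy increment); $\Delta H^k=H(\mathbf{q}(t_0^k+h),\mathbf{p}(t_0^k+h))-H(\mathbf{q}(t_0^k),\mathbf{p}(t_0^k))$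 (exact increment along the exact solution). Convention: "order $o(h^p)$" means bounded in absolute value by $Ch^{p+1}$ for some constant $C>0$ and all sufficiently small $h>0$ (with $t_0^k$ and the initial values fixed). *)

theory Defs
  imports "HOL-Analysis.Analysis"
begin

definition sym_pos_def :: "real^'n^'n \<Rightarrow> bool" where
  "sym_pos_def A \<longleftrightarrow> transpose A = A \<and> (\<forall>x. x \<noteq> 0 \<longrightarrow> x \<bullet> (A *v x) > 0)"

definition kronecker :: "real^'b^'a \<Rightarrow> real^'d^'c \<Rightarrow> real^('b \<times> 'd)^('a \<times> 'c)" where
  "kronecker A B = (\<chi> r s. A $ fst r $ fst s * B $ snd r $ snd s)"

text \<open>Concatenation of a family of vectors into one long vector; the components of a stacked
  vector are indexed by pairs (stage, coordinate), compatibly with \<^const>\<open>kronecker\<close>.\<close>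

definition stack :: "(real^'n)^'s \<Rightarrow> real^('s \<times> 'n)" where
  "stack v = (\<chi> r. v $ fst r $ snd r)"

definition hamiltonian :: "real^'n^'n \<Rightarrow> real^'n^'n \<Rightarrow> real^'n \<Rightarrow> real^'n \<Rightarrow> real" where
  "hamiltonian Q P q p = 1/2 * (q \<bullet> (Q *v q)) + 1/2 * (p \<bullet> (P *v p))"

text \<open>At an endpoint of an interval \<^term>\<open>S\<close> the derivative is one-sided.\<close>

definition pH_trajectory ::
  "real^'n^'n \<Rightarrow> real^'n^'n \<Rightarrow> real^'m^'n \<Rightarrow> real set \<Rightarrow> (real \<Rightarrow> real^'m) \<Rightarrow>
   (real \<Rightarrow> real^'n) \<Rightarrow> (real \<Rightarrow> real^'n) \<Rightarrow> (real \<Rightarrow> real^'m) \<Rightarrow> bool" where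
  "pH_trajectory Q P G S u q p y \<longleftrightarrow>
     (\<forall>t\<in>S.
        (q has_vector_derivative P *v p t) (at t within S) \<and>
        (p has_vector_derivative (- (Q *v q t) + G *v u t)) (at t within S) \<and>
        y t = transpose G *v (P *v p t))"

fun Ck_on :: "nat \<Rightarrow> (real \<Rightarrow> 'a::real_normed_vector) \<Rightarrow> real set \<Rightarrow> bool" where
  "Ck_on 0 f S \<longleftrightarrow> continuous_on S f"
| "Ck_on (Suc k) f S \<longleftrightarrow>
     (\<exists>f'. (\<forall>t\<in>S. (f has_vector_derivative f' t) (at t within S)) \<and> Ck_on k f' S)"

text \<open>Stages are indexed by the type \<^typ>\<open>3\<close>, whose elements are 1, 2 and 3 (= 0).\<close>

definition lobatto_c :: "real^3" where
  "lobatto_c = vector [0, 1/2, 1]"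

definition lobatto_b :: "real^3" where
  "lobatto_b = vector [1/6, 2/3, 1/6]"

definition lobatto_b_hat :: "real^3" where
  "lobatto_b_hat = vector [1/6, 2/3, 1/6]"

definition lobatto_IIIA :: "real^3^3" where
  "lobatto_IIIA = vector [vector [0, 0, 0], vector [5/24, 1/3, -1/24], vector [1/6, 2/3, 1/6]]"

definition lobatto_IIIB :: "real^3^3" where
  "lobatto_IIIB = vector [vector [1/6, -1/6, 0], vector [1/6, 1/3, 0], vector [1/6, 5/6, 0]]"

definition lagrange :: "3 \<Rightarrow> real \<Rightarrow> real" where
  "lagrange i \<tau> = (\<Prod>j\<in>UNIV - {i}. (\<tau> - lobatto_c $ j) / (lobatto_c $ i - lobatto_c $ j))"

definition lagrange_gram :: "real^3^3" where
  "lagrange_gram = (\<chi> i j. integral {0..1} (\<lambda>\<sigma>. lagrange i \<sigma> * lagrange j \<sigma>))"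

definition mass_matrix :: "real^(3 \<times> 'n::finite)^(3 \<times> 'n)" where
  "mass_matrix = kronecker lagrange_gram (mat 1)"

definition effort :: "real^'n^'n \<Rightarrow> (real^'n)^3 \<Rightarrow> (real^'n)^3" where
  "effort A xs = (\<chi> i. A *v (xs $ i))"

definition flow_q :: "real^'n^'n \<Rightarrow> (real^'n)^3 \<Rightarrow> (real^'n)^3" where
  "flow_q P ps = - effort P ps"

definition flow_p ::
  "real^'n^'n \<Rightarrow> real^'m^'n \<Rightarrow> (real \<Rightarrow> real^'m) \<Rightarrow> real \<Rightarrow> real \<Rightarrow> (real^'n)^3 \<Rightarrow> (real^'n)^3" where
  "flow_p Q G u t0 h qs = (\<chi> j. effort Q qs $ j - G *v u (t0 + lobatto_c $ j * h))"

text \<open>\<^term>\<open>qs\<close> and \<^term>\<open>ps\<close> are the internal stages, \<^term>\<open>q4\<close> and \<^term>\<open>p4\<close> the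
  values at the end of a step of size \<^term>\<open>h\<close> from \<^term>\<open>q0\<close> and \<^term>\<open>p0\<close> at time \<^term>\<open>t0\<close>.\<close>

definition lobatto_step ::
  "real^'n^'n \<Rightarrow> real^'n^'n \<Rightarrow> real^'m^'n \<Rightarrow> (real \<Rightarrow> real^'m) \<Rightarrow> real \<Rightarrow> real \<Rightarrow>
   real^'n \<Rightarrow> real^'n \<Rightarrow> (real^'n)^3 \<Rightarrow> (real^'n)^3 \<Rightarrow> real^'n \<Rightarrow> real^'n \<Rightarrow> bool" where
  "lobatto_step Q P G u t0 h q0 p0 qs ps q4 p4 \<longleftrightarrow>
     (\<forall>i. qs $ i = q0 - h *\<^sub>R (\<Sum>j\<in>UNIV. lobatto_IIIA $ i $ j *\<^sub>R flow_q P ps $ j)) \<and>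
     (\<forall>i. ps $ i = p0 - h *\<^sub>R (\<Sum>j\<in>UNIV. lobatto_IIIB $ i $ j *\<^sub>R flow_p Q G u t0 h qs $ j)) \<and>
     q4 = q0 - h *\<^sub>R (\<Sum>j\<in>UNIV. lobatto_b $ j *\<^sub>R flow_q P ps $ j) \<and>
     p4 = p0 - h *\<^sub>R (\<Sum>j\<in>UNIV. lobatto_b_hat $ j *\<^sub>R flow_p Q G u t0 h qs $ j)"

definition supplied_energy ::
  "real^'n^'n \<Rightarrow> real^'n^'n \<Rightarrow> real^'m^'n \<Rightarrow> (real \<Rightarrow> real^'m) \<Rightarrow> real \<Rightarrow> real \<Rightarrow>
   (real^'n)^3 \<Rightarrow> (real^'n)^3 \<Rightarrow> real" where
  "supplied_energy Q P G u t0 h qs ps =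
     - h * (stack (effort Q qs) \<bullet> (mass_matrix *v stack (flow_q P ps)))
     - h * (stack (effort P ps) \<bullet> (mass_matrix *v stack (flow_p Q G u t0 h qs)))"

definition energy_increment ::
  "real^'n^'n \<Rightarrow> real^'n^'n \<Rightarrow> real^'n \<Rightarrow> real^'n \<Rightarrow> real^'n \<Rightarrow> real^'n \<Rightarrow> real" where
  "energy_increment Q P q0 p0 q1 p1 = hamiltonian Q P q1 p1 - hamiltonian Q P q0 p0"

lemma lagrange_simps:
  "lagrange 1 \<tau> = 2*\<tau>^2 - 3*\<tau> + 1"
  "lagrange 2 \<tau> = 4*\<tau> - 4*\<tau>^2"
  "lagrange 3 \<tau> = 2*\<tau>^2 - \<tau>"
proof -
  have "UNIV - {1::3} = {2,3}" "UNIV - {2::3} = {1,3}" "UNIV - {3::3} = {1,2}"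
    unfolding UNIV_3 by auto
  then show "lagrange 1 \<tau> = 2*\<tau>^2 - 3*\<tau> + 1" "lagrange 2 \<tau> = 4*\<tau> - 4*\<tau>^2"
    "lagrange 3 \<tau> = 2*\<tau>^2 - \<tau>"
    by (simp_all add: lagrange_def lobatto_c_def power2_eq_square field_simps)
qed

lemma integral_quartic:
  "integral {0..1} (\<lambda>x::real. a*x^4 + b*x^3 + c*x^2 + d*x + e) = a/5 + b/4 + c/3 + d/2 + e"
proof (rule integral_unique)
  have "((\<lambda>x::real. a*x^4 + b*x^3 + c*x^2 + d*x + e) has_integral
      (a/5*1^5 + b/4*1^4 + c/3*1^3 + d/2*1^2 + e*1) - (a/5*0^5 + b/4*0^4 + c/3*0^3 + d/2*0^2 + e*0)) {0..1}"
    by (rule fundamental_theorem_of_calculus)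
       (auto simp flip: has_real_derivative_iff_has_vector_derivative intro!: derivative_eq_intros)
  then show "((\<lambda>x::real. a*x^4 + b*x^3 + c*x^2 + d*x + e) has_integral a/5 + b/4 + c/3 + d/2 + e) {0..1}"
    by simp
qed

lemma lagrange_gram_eq:
  "lagrange_gram =
     vector [vector [2/15, 1/15, -1/30], vector [1/15, 8/15, 1/15], vector [-1/30, 1/15, 2/15]]"
proof -
  have *: "integral {0..1} f = a/5 + b/4 + c/3 + d/2 + e"
    if "\<And>x. f x = a*x^4 + b*x^3 + c*x^2 + d*x + e" for f :: "real \<Rightarrow> real" and a b c d e
    using integral_quartic[of a b c d e] unfolding that[symmetric] .
  have "integral {0..1} (\<lambda>x. lagrange 1 x * lagrange 1 x) = 2/15"
    by (subst *[of _ 4 "-12" 13 "-6" 1])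
       (simp_all add: lagrange_simps power2_eq_square power3_eq_cube power4_eq_xxxx algebra_simps)
  moreover have "integral {0..1} (\<lambda>x. lagrange 1 x * lagrange 2 x) = 1/15"
    by (subst *[of _ "-8" 20 "-16" 4 0])
       (simp_all add: lagrange_simps power2_eq_square power3_eq_cube power4_eq_xxxx algebra_simps)
  moreover have "integral {0..1} (\<lambda>x. lagrange 1 x * lagrange 3 x) = -1/30"
    by (subst *[of _ 4 "-8" 5 "-1" 0])
       (simp_all add: lagrange_simps power2_eq_square power3_eq_cube power4_eq_xxxx algebra_simps)
  moreover have "integral {0..1} (\<lambda>x. lagrange 2 x * lagrange 2 x) = 8/15"
    by (subst *[of _ 16 "-32" 16 0 0])
       (simp_all add: lagrange_simps power2_eq_square power3_eq_cube power4_eq_xxxx algebra_simps)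
  moreover have "integral {0..1} (\<lambda>x. lagrange 2 x * lagrange 3 x) = 1/15"
    by (subst *[of _ "-8" 12 "-4" 0 0])
       (simp_all add: lagrange_simps power2_eq_square power3_eq_cube power4_eq_xxxx algebra_simps)
  moreover have "integral {0..1} (\<lambda>x. lagrange 3 x * lagrange 3 x) = 2/15"
    by (subst *[of _ 4 "-4" 1 0 0])
       (simp_all add: lagrange_simps power2_eq_square power3_eq_cube power4_eq_xxxx algebra_simps)
  ultimately show ?thesis
    by (simp add: lagrange_gram_def vec_eq_iff forall_3 mult.commute)
qed

text \<open>The implicit scheme determines its stages uniquely, so that quantifying over all solutions
  of the stage equations is the same as speaking of the numerical step.\<close>

lemma lobatto_step_ex1:
  fixes Q P :: "real^'n^'n" and G :: "real^'m^'n"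
  assumes "sym_pos_def Q" "sym_pos_def P"
  shows "\<exists>!z. case z of (qs, ps, q4, p4) \<Rightarrow> lobatto_step Q P G u t0 h q0 p0 qs ps q4 p4"
proof -
  define v where "v j = G *v u (t0 + lobatto_c $ j * h)" for j :: 3
  define p where "p x = (vector
      [p0 - h *\<^sub>R ((1/6) *\<^sub>R (Q *v q0 - v 1) - (1/6) *\<^sub>R (Q *v x - v 2)),
       p0 - h *\<^sub>R ((1/6) *\<^sub>R (Q *v q0 - v 1) + (1/3) *\<^sub>R (Q *v x - v 2)),
       p0 - h *\<^sub>R ((1/6) *\<^sub>R (Q *v q0 - v 1) + (5/6) *\<^sub>R (Q *v x - v 2))] :: (real^'n)^3)" for x
  define q where "q x = (vector [q0, x,
      q0 + h *\<^sub>R ((1/6) *\<^sub>R (P *v p x $ 1) + (2/3) *\<^sub>R (P *v p x $ 2) + (1/6) *\<^sub>R (P *v p x $ 3))]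
      :: (real^'n)^3)" for x
  define r where "r x = q0 + h *\<^sub>R ((5/24) *\<^sub>R (P *v p x $ 1) + (1/3) *\<^sub>R (P *v p x $ 2)
      - (1/24) *\<^sub>R (P *v p x $ 3))" for x
  define L where "L x = x + (h^2/24) *\<^sub>R (P *v (Q *v x))" for x
  have r: "r x = r 0 - (h^2/24) *\<^sub>R (P *v (Q *v x))" for x
    unfolding r_def p_def
    by (simp add: matrix_vector_mult_diff_distrib matrix_vector_right_distrib
        matrix_vector_mult_scaleR vec_eq_iff power2_eq_square algebra_simps)
  have lin: "linear L"
    unfolding L_def
    by (rule linearI) (simp_all add: matrix_vector_right_distrib matrix_vector_mult_scaleR
        algebra_simps)
  have "inj L"
  proof (rule linear_injective_0[OF lin, THEN iffD2], intro allI impI)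
    fix x assume "L x = 0"
    then have "(Q *v x) \<bullet> L x = 0" by simp
    then have *: "x \<bullet> (Q *v x) + h^2/24 * ((Q *v x) \<bullet> (P *v (Q *v x))) = 0"
      by (simp add: L_def inner_add_right inner_commute)
    have "(Q *v x) \<bullet> (P *v (Q *v x)) \<ge> 0"
      using assms(2) unfolding sym_pos_def_def by (cases "Q *v x = 0") (auto intro: less_imp_le)
    then have "h^2/24 * ((Q *v x) \<bullet> (P *v (Q *v x))) \<ge> 0" by simp
    with * have "\<not> x \<bullet> (Q *v x) > 0" by linarith
    then show "x = 0" using assms(1) unfolding sym_pos_def_def by blast
  qed
  moreover from lin this have "surj L" by (rule linear_inj_imp_surj)
  ultimately obtain x where x: "\<And>x'. L x' = r 0 \<longleftrightarrow> x' = x"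
    by (metis injD surjD)
  have fix_iff: "x' = r x' \<longleftrightarrow> x' = x" for x'
    using x[of x'] by (subst r) (auto simp: L_def algebra_simps)
  have stages: "(\<forall>i. qs $ i = q0 - h *\<^sub>R (\<Sum>j\<in>UNIV. lobatto_IIIA $ i $ j *\<^sub>R flow_q P ps $ j)) \<and>
     (\<forall>i. ps $ i = p0 - h *\<^sub>R (\<Sum>j\<in>UNIV. lobatto_IIIB $ i $ j *\<^sub>R flow_p Q G u t0 h qs $ j))
     \<longleftrightarrow> qs = q x \<and> ps = p x" for qs ps
  proof -
    have "(\<forall>i. qs $ i = q0 - h *\<^sub>R (\<Sum>j\<in>UNIV. lobatto_IIIA $ i $ j *\<^sub>R flow_q P ps $ j)) \<longleftrightarrow>
      qs $ 1 = q0 \<and>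
      qs $ 2 = q0 + h *\<^sub>R ((5/24) *\<^sub>R (P *v ps $ 1) + (1/3) *\<^sub>R (P *v ps $ 2)
        - (1/24) *\<^sub>R (P *v ps $ 3)) \<and>
      qs $ 3 = q0 + h *\<^sub>R ((1/6) *\<^sub>R (P *v ps $ 1) + (2/3) *\<^sub>R (P *v ps $ 2)
        + (1/6) *\<^sub>R (P *v ps $ 3))"
      by (simp add: forall_3 sum_3 lobatto_IIIA_def flow_q_def effort_def algebra_simps)
    moreover have "(\<forall>i. ps $ i = p0 - h *\<^sub>R (\<Sum>j\<in>UNIV. lobatto_IIIB $ i $ j *\<^sub>R flow_p Q G u t0 h qs $ j))
      \<longleftrightarrow>
      ps $ 1 = p0 - h *\<^sub>R ((1/6) *\<^sub>R (Q *v qs $ 1 - v 1) - (1/6) *\<^sub>R (Q *v qs $ 2 - v 2)) \<and>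
      ps $ 2 = p0 - h *\<^sub>R ((1/6) *\<^sub>R (Q *v qs $ 1 - v 1) + (1/3) *\<^sub>R (Q *v qs $ 2 - v 2)) \<and>
      ps $ 3 = p0 - h *\<^sub>R ((1/6) *\<^sub>R (Q *v qs $ 1 - v 1) + (5/6) *\<^sub>R (Q *v qs $ 2 - v 2))"
      by (simp add: forall_3 sum_3 lobatto_IIIB_def flow_p_def effort_def v_def algebra_simps)
    moreover have "ps = p y \<longleftrightarrow>
      ps $ 1 = p0 - h *\<^sub>R ((1/6) *\<^sub>R (Q *v q0 - v 1) - (1/6) *\<^sub>R (Q *v y - v 2)) \<and>
      ps $ 2 = p0 - h *\<^sub>R ((1/6) *\<^sub>R (Q *v q0 - v 1) + (1/3) *\<^sub>R (Q *v y - v 2)) \<and>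
      ps $ 3 = p0 - h *\<^sub>R ((1/6) *\<^sub>R (Q *v q0 - v 1) + (5/6) *\<^sub>R (Q *v y - v 2))" for y
      by (simp add: p_def vec_eq_iff[of ps] forall_3)
    moreover have "qs = q y \<longleftrightarrow> qs $ 1 = q0 \<and> qs $ 2 = y \<and>
      qs $ 3 = q0 + h *\<^sub>R ((1/6) *\<^sub>R (P *v p y $ 1) + (2/3) *\<^sub>R (P *v p y $ 2)
        + (1/6) *\<^sub>R (P *v p y $ 3))" for y
      by (simp add: q_def vec_eq_iff[of qs] forall_3)
    ultimately show ?thesis
      using fix_iff[of "qs $ 2"] fix_iff[of x] unfolding r_def by (smt (verit))
  qed
  show ?thesis
    unfolding lobatto_step_def conj_assoc[symmetric] stages by auto
qed

end

theory Submission
  imports Defs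
begin

text \<open>By symmetry of the Gram matrix the exchange of power between \<open>q\<close> and \<open>p\<close> drops out of the
  supplied energy, leaving \<open>h * (\<Sum>i j. m i j * (P p\<^sub>i \<bullet> G u\<^sub>j))\<close>, whereas the exact energy
  increment is the integral of \<open>P p \<bullet> G u\<close>. All quantities are expanded in powers of \<open>h\<close>; the
  expansions of the implicit stages are bootstrapped from boundedness, each pass through the scheme
  gaining two orders. The \<open>k\<close>-th coefficient of a stage of \<open>p\<close> is \<open>stage_factor i k\<close> times that of
  the exact solution, and although the stages themselves are only second order accurate, their moments
  satisfy \<open>\<Sum>i j. m i j * (stage_factor i a * c\<^sub>j ^ b) = 1 / (a + b + 1)\<close> for \<open>a + b < 4\<close>, as
  if the product were integrated exactly. The numerical end values have order four, so the numerical
  energy increment agrees with the exact one up to \<open>h ^ 5\<close>.\<close>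

section \<open>Asymptotic expansions at \<open>0\<close> from the right\<close>

text \<open>Order \<open>0\<close> is mere boundedness near \<open>0\<close> from the right, the
  starting point of each bootstrap. Taking \<open>a\<close> as an infinite sequence lets one family
  of coefficients serve all orders.\<close>

definition expands :: "nat \<Rightarrow> (real \<Rightarrow> 'a::real_normed_vector) \<Rightarrow> (nat \<Rightarrow> 'a) \<Rightarrow> bool" where
  "expands n f a \<longleftrightarrow>
     (\<exists>C. \<forall>\<^sub>F h in at_right 0. norm (f h - (\<Sum>i<n. h ^ i *\<^sub>R a i)) \<le> C * h ^ n)"

lemma expandsI:
  assumes "\<forall>\<^sub>F h in at_right 0. norm (f h - (\<Sum>i<n. h ^ i *\<^sub>R a i)) \<le> C * h ^ n"
  shows "expands n f a"
  using assms unfolding expands_def by blast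

lemma expandsE:
  assumes "expands n f a"
  obtains C where "C > 0" "\<forall>\<^sub>F h in at_right 0. norm (f h - (\<Sum>i<n. h ^ i *\<^sub>R a i)) \<le> C * h ^ n"
proof -
  obtain C where C: "\<forall>\<^sub>F h in at_right 0. norm (f h - (\<Sum>i<n. h ^ i *\<^sub>R a i)) \<le> C * h ^ n"
    using assms unfolding expands_def by blast
  have "\<forall>\<^sub>F h in at_right 0. norm (f h - (\<Sum>i<n. h ^ i *\<^sub>R a i)) \<le> (\<bar>C\<bar> + 1) * h ^ n"
    using C eventually_at_right_less[of "0::real"]
  proof eventually_elim
    case (elim h)
    have "C * h ^ n \<le> (\<bar>C\<bar> + 1) * h ^ n"
      using elim by (intro mult_right_mono) auto
    then show ?case using elim by linarith
  qed
  then show thesis using that[of "\<bar>C\<bar> + 1"] by auto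
qed

lemma expands_cong:
  assumes "expands n f a" "\<And>h. h > 0 \<Longrightarrow> f h = g h" "\<And>i. i < n \<Longrightarrow> a i = b i"
  shows "expands n g b"
proof -
  obtain C where C: "\<forall>\<^sub>F h in at_right 0. norm (f h - (\<Sum>i<n. h ^ i *\<^sub>R a i)) \<le> C * h ^ n"
    using assms(1) by (rule expandsE)
  show ?thesis
    by (rule expandsI[of _ _ _ C])
      (use C eventually_at_right_less[of "0::real"] in eventually_elim, use assms in simp)
qed

lemma expands_0_coeffs: "expands 0 f a \<longleftrightarrow> expands 0 f b"
  by (simp add: expands_def)

text \<open>For \<open>h > 0\<close> the remainder at order \<open>Suc n\<close> is \<open>h\<close>
  times the remainder of the difference quotient at order \<open>n\<close>. Induction on the order
  thus splits off leading coefficients.\<close>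

lemma expands_Suc:
  "expands (Suc n) f a \<longleftrightarrow> expands n (\<lambda>h. (f h - a 0) /\<^sub>R h) (\<lambda>i. a (Suc i))"
proof -
  have "norm (f h - (\<Sum>i<Suc n. h ^ i *\<^sub>R a i)) \<le> C * h ^ Suc n \<longleftrightarrow>
      norm ((f h - a 0) /\<^sub>R h - (\<Sum>i<n. h ^ i *\<^sub>R a (Suc i))) \<le> C * h ^ n" if "h > 0" for h C
  proof -
    have "f h - (\<Sum>i<Suc n. h ^ i *\<^sub>R a i) =
        h *\<^sub>R ((f h - a 0) /\<^sub>R h - (\<Sum>i<n. h ^ i *\<^sub>R a (Suc i)))"
      using that unfolding sum.lessThan_Suc_shift
      by (simp add: algebra_simps scaleR_sum_right)
    then have "norm (f h - (\<Sum>i<Suc n. h ^ i *\<^sub>R a i)) =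
        h * norm ((f h - a 0) /\<^sub>R h - (\<Sum>i<n. h ^ i *\<^sub>R a (Suc i)))"
      using that by simp
    then show ?thesis using that by simp
  qed
  then have "(\<forall>\<^sub>F h in at_right 0. norm (f h - (\<Sum>i<Suc n. h ^ i *\<^sub>R a i)) \<le> C * h ^ Suc n) \<longleftrightarrow>
      (\<forall>\<^sub>F h in at_right 0. norm ((f h - a 0) /\<^sub>R h - (\<Sum>i<n. h ^ i *\<^sub>R a (Suc i))) \<le> C * h ^ n)" for C
    by (intro eventually_cong[OF eventually_at_right_less[of "0::real"]]) auto
  then show ?thesis unfolding expands_def by simp
qed

text \<open>The dropped term joins the remainder at the cost of \<open>norm (a n)\<close> in the
  constant, and \<open>h < 1\<close> gives \<open>h ^ Suc n \<le> h ^ n\<close>.\<close>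

lemma expands_SucD:
  assumes "expands (Suc n) f a"
  shows "expands n f a"
proof -
  obtain C where C: "C > 0" "\<forall>\<^sub>F h in at_right 0. norm (f h - (\<Sum>i<Suc n. h ^ i *\<^sub>R a i)) \<le> C * h ^ Suc n"
    using assms by (rule expandsE)
  have "\<forall>\<^sub>F h in at_right 0. norm (f h - (\<Sum>i<n. h ^ i *\<^sub>R a i)) \<le> (C + norm (a n)) * h ^ n"
    using C(2) eventually_at_right_real[OF zero_less_one]
  proof eventually_elim
    case (elim h)
    have "f h - (\<Sum>i<n. h ^ i *\<^sub>R a i) = (f h - (\<Sum>i<Suc n. h ^ i *\<^sub>R a i)) + h ^ n *\<^sub>R a n"
      by simp
    also have "norm \<dots> \<le> C * h ^ Suc n + h ^ n * norm (a n)"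
      using elim by (intro norm_triangle_le add_mono) auto
    also have "C * h ^ Suc n \<le> C * h ^ n"
      using C(1) elim by (intro mult_left_mono power_decreasing) auto
    finally show ?case by (simp add: algebra_simps)
  qed
  then show ?thesis by (rule expandsI)
qed

lemma expands_mono:
  assumes "expands n f a" "m \<le> n"
  shows "expands m f a"
  using assms(2,1) by (induction m rule: inc_induct) (auto intro: expands_SucD)

section \<open>Closure of expansions under algebraic operations\<close>

lemma expands_const: "expands n (\<lambda>h. c) (\<lambda>i. if i = 0 then c else 0)"
proof (cases n)
  case (Suc m)
  show ?thesis
    unfolding Suc by (rule expandsI[where C = 0]) (simp del: sum.lessThan_Suc add: sum.lessThan_Suc_shift)
qed (auto intro!: expandsI[where C = "norm c"])

lemma expands_add:
  assumes "expands n f a" "expands n g b"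
  shows "expands n (\<lambda>h. f h + g h) (\<lambda>i. a i + b i)"
proof -
  obtain C where C: "\<forall>\<^sub>F h in at_right 0. norm (f h - (\<Sum>i<n. h ^ i *\<^sub>R a i)) \<le> C * h ^ n"
    using assms(1) by (rule expandsE)
  obtain D where D: "\<forall>\<^sub>F h in at_right 0. norm (g h - (\<Sum>i<n. h ^ i *\<^sub>R b i)) \<le> D * h ^ n"
    using assms(2) by (rule expandsE)
  have "\<forall>\<^sub>F h in at_right 0.
      norm (f h + g h - (\<Sum>i<n. h ^ i *\<^sub>R (a i + b i))) \<le> (C + D) * h ^ n"
    using C D
  proof eventually_elim
    case (elim h)
    have "f h + g h - (\<Sum>i<n. h ^ i *\<^sub>R (a i + b i)) =
        (f h - (\<Sum>i<n. h ^ i *\<^sub>R a i)) + (g h - (\<Sum>i<n. h ^ i *\<^sub>R b i))"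
      by (simp add: sum.distrib scaleR_right_distrib)
    also have "norm \<dots> \<le> C * h ^ n + D * h ^ n"
      using elim by (intro norm_triangle_le add_mono)
    finally show ?case by (simp add: algebra_simps)
  qed
  then show ?thesis by (rule expandsI)
qed

lemma expands_linear:
  assumes "bounded_linear L" "expands n f a"
  shows "expands n (\<lambda>h. L (f h)) (\<lambda>i. L (a i))"
proof -
  interpret L: bounded_linear L by fact
  obtain C where C: "\<forall>\<^sub>F h in at_right 0. norm (f h - (\<Sum>i<n. h ^ i *\<^sub>R a i)) \<le> C * h ^ n"
    using assms(2) by (rule expandsE)
  obtain K where K: "K \<ge> 0" "\<And>x. norm (L x) \<le> norm x * K"
    using L.nonneg_bounded by blast
  have "\<forall>\<^sub>F h in at_right 0. norm (L (f h) - (\<Sum>i<n. h ^ i *\<^sub>R L (a i))) \<le> C * K * h ^ n"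
    using C
  proof eventually_elim
    case (elim h)
    have "L (f h) - (\<Sum>i<n. h ^ i *\<^sub>R L (a i)) = L (f h - (\<Sum>i<n. h ^ i *\<^sub>R a i))"
      by (simp add: L.diff L.sum L.scaleR)
    also have "norm \<dots> \<le> C * h ^ n * K"
      using K elim by (meson mult_right_mono order_trans)
    finally show ?case by (simp add: mult_ac)
  qed
  then show ?thesis by (rule expandsI)
qed

lemmas expands_matrix = expands_linear[OF matrix_vector_mul_bounded_linear]
lemmas expands_scaleR = expands_linear[OF bounded_linear_scaleR_right]
lemmas expands_cmult = expands_linear[OF bounded_linear_mult_right]

lemma expands_diff:
  assumes "expands n f a" "expands n g b"
  shows "expands n (\<lambda>h. f h - g h) (\<lambda>i. a i - b i)"
  using expands_add[OF assms(1) expands_linear[OF bounded_linear_minus[OF bounded_linear_ident] assms(2)]]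
  by simp

lemma expands_sum:
  assumes "\<And>j. j \<in> I \<Longrightarrow> expands n (f j) (a j)"
  shows "expands n (\<lambda>h. \<Sum>j\<in>I. f j h) (\<lambda>i. \<Sum>j\<in>I. a j i)"
proof (cases "finite I")
  case True
  then show ?thesis
    using assms
    by (induction I) (auto intro: expands_add expands_cong[OF expands_const[of n 0]])
qed (auto intro: expands_cong[OF expands_const[of n 0]])

text \<open>The difference quotient of \<open>h *\<^sub>R f h\<close> is \<open>f\<close> itself.
  This is the source of every gain of order in the scheme.\<close>

lemma expands_times_h:
  assumes "expands n f a"
  shows "expands (Suc n) (\<lambda>h. h *\<^sub>R f h) (case_nat 0 a)"
  unfolding expands_Suc by (rule expands_cong[OF assms]) auto

lemma expands_0_times_h:
  assumes "expands 0 f a"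
  shows "expands 0 (\<lambda>h. h *\<^sub>R f h) b"
  using expands_SucD[OF expands_times_h[OF assms]] expands_0_coeffs by blast

lemma expands_inner_0:
  fixes f g :: "real \<Rightarrow> 'a::real_inner"
  assumes "expands 0 f a" "expands 0 g b"
  shows "expands 0 (\<lambda>h. f h \<bullet> g h) c"
proof -
  obtain C where C: "\<forall>\<^sub>F h in at_right 0. norm (f h - (\<Sum>i<0. h ^ i *\<^sub>R a i)) \<le> C * h ^ 0"
    using assms(1) by (rule expandsE)
  obtain D where D: "\<forall>\<^sub>F h in at_right 0. norm (g h - (\<Sum>i<0. h ^ i *\<^sub>R b i)) \<le> D * h ^ 0"
    using assms(2) by (rule expandsE)
  have "\<forall>\<^sub>F h in at_right 0. norm (f h \<bullet> g h - (\<Sum>i<0. h ^ i *\<^sub>R c i)) \<le> (C * D) * h ^ 0"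
    using C D
  proof eventually_elim
    case (elim h)
    have "\<bar>f h \<bullet> g h\<bar> \<le> norm (f h) * norm (g h)"
      by (rule Cauchy_Schwarz_ineq2)
    also have "\<dots> \<le> C * D"
      using elim by (intro mult_mono) (auto intro: order_trans[OF norm_ge_zero])
    finally show ?case by simp
  qed
  then show ?thesis by (rule expandsI)
qed

text \<open>By induction on the order: splitting off the leading coefficient writes
  \<open>f h = a 0 + h *\<^sub>R f' h\<close>, where \<open>f'\<close> expands to one order less.\<close>

lemma expands_inner:
  fixes f g :: "real \<Rightarrow> 'a::real_inner"
  assumes "expands n f a" "expands n g b"
  shows "expands n (\<lambda>h. f h \<bullet> g h) (\<lambda>k. \<Sum>i\<le>k. a i \<bullet> b (k - i))"
  using assms
proof (induction n arbitrary: f a)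
  case 0
  then show ?case by (rule expands_inner_0)
next
  case (Suc n)
  define f' where "f' h = (f h - a 0) /\<^sub>R h" for h
  have f': "expands n f' (\<lambda>i. a (Suc i))"
    using Suc.prems(1) unfolding expands_Suc f'_def .
  have "expands n (\<lambda>h. f' h \<bullet> g h) (\<lambda>k. \<Sum>i\<le>k. a (Suc i) \<bullet> b (k - i))"
    by (rule Suc.IH[OF f' expands_SucD[OF Suc.prems(2)]])
  from expands_add[OF expands_linear[OF bounded_linear_inner_right Suc.prems(2), of "a 0"]
      expands_times_h[OF this]]
  show ?case
  proof (rule expands_cong)
    fix h :: real assume "h > 0"
    then have "f h = a 0 + h *\<^sub>R f' h" by (simp add: f'_def)
    then show "a 0 \<bullet> g h + h *\<^sub>R (f' h \<bullet> g h) = f h \<bullet> g h"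
      by (simp add: inner_add_left)
  next
    fix k
    show "a 0 \<bullet> b k + (case k of 0 \<Rightarrow> 0 | Suc k \<Rightarrow> \<Sum>i\<le>k. a (Suc i) \<bullet> b (k - i)) =
        (\<Sum>i\<le>k. a i \<bullet> b (k - i))"
      by (cases k) (simp_all del: sum.atMost_Suc add: sum.atMost_Suc_shift)
  qed
qed

text \<open>The filter \<open>at_right 0\<close> does not see the value at \<open>0\<close>, yet for
  the node \<open>c = 0\<close> the rescaled function is constantly \<open>f 0\<close>; hence the
  hypothesis \<open>f 0 = a 0\<close>.\<close>

lemma expands_rescale:
  assumes "expands n f a" "f 0 = a 0" "c \<ge> 0"
  shows "expands n (\<lambda>h. f (c * h)) (\<lambda>i. c ^ i *\<^sub>R a i)"
proof (cases "c = 0")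
  case True
  show ?thesis
    by (rule expands_cong[OF expands_const[of n "a 0"]]) (auto simp: True assms(2) power_0_left)
next
  case False
  obtain C where C: "\<forall>\<^sub>F h in at_right 0. norm (f h - (\<Sum>i<n. h ^ i *\<^sub>R a i)) \<le> C * h ^ n"
    using assms(1) by (rule expandsE)
  have "filterlim (\<lambda>h. c * h) (at_right 0) (at_right (0::real))"
    using filterlim_times_pos[OF filterlim_ident, of c 0 "0 * c"] False assms(3)
    by (simp add: mult.commute)
  from eventually_compose_filterlim[OF C this]
  have "\<forall>\<^sub>F h in at_right 0.
      norm (f (c * h) - (\<Sum>i<n. h ^ i *\<^sub>R (c ^ i *\<^sub>R a i))) \<le> (C * c ^ n) * h ^ n"
    by eventually_elim (simp add: power_mult_distrib mult_ac)
  then show ?thesis by (rule expandsI)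
qed

section \<open>Expansions from continuity and differentiability\<close>

lemma expands_continuous:
  assumes "0 < d" "continuous_on {0..d} f"
  shows "expands 0 f a"
proof -
  obtain C where C: "\<And>x. x \<in> {0..d} \<Longrightarrow> norm (f x) \<le> C"
    using compact_imp_bounded[OF compact_continuous_image[OF assms(2) compact_Icc]]
    unfolding bounded_iff by blast
  have "\<forall>\<^sub>F h in at_right 0. norm (f h - (\<Sum>i<0. h ^ i *\<^sub>R a i)) \<le> C * h ^ 0"
    using eventually_at_right_real[OF assms(1)] by eventually_elim (auto intro: C)
  then show ?thesis by (rule expandsI)
qed

text \<open>The difference \<open>g\<close> of \<open>f\<close> and the integrated polynomial
  vanishes at \<open>0\<close> and has a derivative bounded by \<open>C * x ^ n\<close>. The mean
  value inequality then bounds \<open>g\<close>, without any integral of \<open>f'\<close>.\<close>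

lemma expands_integrate:
  fixes f :: "real \<Rightarrow> 'a::real_normed_vector"
  assumes "0 < d"
    and deriv: "\<And>x. x \<in> {0..d} \<Longrightarrow> (f has_vector_derivative f' x) (at x within {0..d})"
    and "expands n f' a"
  shows "expands (Suc n) f (case_nat (f 0) (\<lambda>i. a i /\<^sub>R real (Suc i)))"
proof -
  let ?b = "case_nat (f 0) (\<lambda>i. a i /\<^sub>R real (Suc i))"
  define g where "g x = f x - (\<Sum>i<Suc n. x ^ i *\<^sub>R ?b i)" for x
  obtain C where C: "C > 0" "\<forall>\<^sub>F h in at_right 0. norm (f' h - (\<Sum>i<n. h ^ i *\<^sub>R a i)) \<le> C * h ^ n"
    using assms(3) by (rule expandsE)
  then obtain e where e: "e > 0" "\<And>x. 0 < x \<Longrightarrow> x < e \<Longrightarrow> norm (f' x - (\<Sum>i<n. x ^ i *\<^sub>R a i)) \<le> C * x ^ n"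
    unfolding eventually_at_right_field by auto
  have "((\<lambda>x. x ^ Suc i *\<^sub>R (a i /\<^sub>R real (Suc i))) has_vector_derivative x ^ i *\<^sub>R a i) (at x within S)"
    for i x and S :: "real set"
    by (auto intro!: derivative_eq_intros simp del: of_nat_Suc power_Suc)
  then have "((\<lambda>x. \<Sum>i<n. x ^ Suc i *\<^sub>R (a i /\<^sub>R real (Suc i)))
      has_vector_derivative (\<Sum>i<n. x ^ i *\<^sub>R a i)) (at x within S)" for x and S :: "real set"
    by (intro has_vector_derivative_sum)
  from has_vector_derivative_diff[OF has_vector_derivative_diff[OF deriv has_vector_derivative_const]
      this, of _ "f 0"]
  have g_deriv: "(g has_vector_derivative f' x - (\<Sum>i<n. x ^ i *\<^sub>R a i)) (at x within {0..d})"
    if "x \<in> {0..d}" for x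
    using that unfolding g_def sum.lessThan_Suc_shift by (simp add: diff_diff_eq)
  have g0: "g 0 = 0"
    unfolding g_def sum.lessThan_Suc_shift by simp
  \<comment> \<open>The bound \<open>min d e\<close> keeps \<open>h\<close> both inside the domain
    of \<open>f\<close> and where the estimate on \<open>f'\<close> holds.\<close>
  have "norm (f h - (\<Sum>i<Suc n. h ^ i *\<^sub>R ?b i)) \<le> C * h ^ Suc n" if h: "h > 0" "h < min d e" for h
  proof -
    have "norm (g h - g 0) \<le> C / Suc n * h ^ Suc n - C / Suc n * 0 ^ Suc n"
    proof (rule differentiable_bound_general)
      show "continuous_on {0..h} g"
        using continuous_on_subset[OF continuous_on_vector_derivative[OF g_deriv]] h by auto
      show "(g has_vector_derivative f' x - (\<Sum>i<n. x ^ i *\<^sub>R a i)) (at x)" if "0 < x" "x < h" for x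
        using g_deriv[of x] that h at_within_interior[of x "{0..d}"] by auto
      show "((\<lambda>x. C / Suc n * x ^ Suc n) has_vector_derivative C * x ^ n) (at x)" for x :: real
        by (auto intro!: derivative_eq_intros simp flip: has_real_derivative_iff_has_vector_derivative
            simp del: of_nat_Suc power_Suc)
      show "norm (f' x - (\<Sum>i<n. x ^ i *\<^sub>R a i)) \<le> C * x ^ n" if "0 < x" "x < h" for x
        using e(2)[of x] that h by auto
    qed (use h in \<open>auto intro!: continuous_intros\<close>)
    also have "\<dots> \<le> C * h ^ Suc n"
      using C(1) h by (auto simp: field_simps)
    finally show ?thesis using g0 by (simp add: g_def)
  qed
  then have "\<forall>\<^sub>F h in at_right 0. norm (f h - (\<Sum>i<Suc n. h ^ i *\<^sub>R ?b i)) \<le> C * h ^ Suc n"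
    unfolding eventually_at_right_field using assms(1) e(1) by (intro exI[of _ "min d e"]) auto
  then show ?thesis by (rule expandsI)
qed

lemma has_vector_derivative_translate:
  assumes "(f has_vector_derivative f') (at (a + x) within {a..b})"
  shows "((\<lambda>x. f (a + x)) has_vector_derivative f') (at x within {0..b - a})"
proof -
  have "((+) a has_vector_derivative 1) (at x within {0..b - a})"
    by (auto intro!: derivative_eq_intros)
  from vector_diff_chain_within[OF this, of f f'] assms show ?thesis
    by (simp add: o_def)
qed

text \<open>By induction on the smoothness: the derivative expands to one order less and is
  integrated termwise. The coefficients stay abstract except for the first, whose value
  \<open>expands_rescale\<close> requires.\<close>

lemma expands_Ck_on:
  fixes f :: "real \<Rightarrow> 'a::real_normed_vector"
  assumes "a < b" "Ck_on n f {a..b}"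
  obtains c where "c 0 = f a" "expands n (\<lambda>h. f (a + h)) c"
proof -
  have "\<exists>c. c 0 = f a \<and> expands n (\<lambda>h. f (a + h)) c"
    using assms(2)
  proof (induction n arbitrary: f)
    case 0
    then have "continuous_on {0..b - a} (\<lambda>h. f (a + h))"
      by (auto intro!: continuous_on_compose2[of "{a..b}" f] continuous_intros)
    then have "expands 0 (\<lambda>h. f (a + h)) (\<lambda>_. f a)"
      using assms(1) by (intro expands_continuous) auto
    then show ?case by (intro exI[of _ "\<lambda>_. f a"]) simp
  next
    case (Suc n)
    then obtain f' where f': "\<And>t. t \<in> {a..b} \<Longrightarrow> (f has_vector_derivative f' t) (at t within {a..b})"
      "Ck_on n f' {a..b}" unfolding Ck_on.simps by blast
    obtain c where c: "expands n (\<lambda>h. f' (a + h)) c"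
      using Suc.IH[OF f'(2)] by blast
    have "expands (Suc n) (\<lambda>h. f (a + h)) (case_nat (f (a + 0)) (\<lambda>i. c i /\<^sub>R real (Suc i)))"
      by (rule expands_integrate[where d = "b - a", OF _ has_vector_derivative_translate[OF f'(1)] c])
        (use assms(1) in auto)
    then show ?case
      by (intro exI[of _ "case_nat (f a) (\<lambda>i. c i /\<^sub>R real (Suc i))"]) (simp del: of_nat_Suc)
  qed
  then show thesis using that by blast
qed

text \<open>Boundedness of implicitly defined stages: the perturbation
  \<open>h\<^sup>2 *\<^sub>R L (x h)\<close> is eventually at most half of \<open>x h\<close>.\<close>

lemma expands_0_perturbed:
  assumes "bounded_linear L" "expands 0 (\<lambda>h. x h + h\<^sup>2 *\<^sub>R L (x h)) a"
  shows "expands 0 x b"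
proof -
  obtain C where C: "\<forall>\<^sub>F h in at_right 0. norm (x h + h\<^sup>2 *\<^sub>R L (x h) - (\<Sum>i<0. h ^ i *\<^sub>R a i)) \<le> C * h ^ 0"
    using assms(2) by (rule expandsE)
  obtain K where K: "K > 0" "\<And>x. norm (L x) \<le> norm x * K"
    using bounded_linear.pos_bounded[OF assms(1)] by blast
  have "((\<lambda>h. h\<^sup>2 * K) \<longlongrightarrow> 0\<^sup>2 * K) (at_right (0::real))"
    by (intro tendsto_intros)
  then have "\<forall>\<^sub>F h in at_right 0. h\<^sup>2 * K < 1/2"
    by (rule order_tendstoD) simp
  then have "\<forall>\<^sub>F h in at_right 0. norm (x h - (\<Sum>i<0. h ^ i *\<^sub>R b i)) \<le> (2 * C) * h ^ 0"
    using C
  proof eventually_elim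
    case (elim h)
    have "norm (h\<^sup>2 *\<^sub>R L (x h)) \<le> h\<^sup>2 * K * norm (x h)"
      using mult_left_mono[OF K(2)[of "x h"], of "h\<^sup>2"] by (simp add: mult_ac)
    also have "\<dots> \<le> 1/2 * norm (x h)"
      using elim by (intro mult_right_mono) auto
    finally have "norm (h\<^sup>2 *\<^sub>R L (x h)) \<le> 1/2 * norm (x h)" .
    moreover have "norm (x h) \<le> norm (x h + h\<^sup>2 *\<^sub>R L (x h)) + norm (h\<^sup>2 *\<^sub>R L (x h))"
      by (metis add_diff_cancel_right' norm_triangle_ineq4)
    ultimately show ?case using elim by simp
  qed
  then show ?thesis by (rule expandsI)
qed

section \<open>Expansions of the solution and of the stages\<close>

text \<open>The formal power series solution of q' = P p, p' = v - Q q, with equal powers compared.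
  The exact solution and the stages are both expressed through these coefficients, so no derivatives
  of the solution have to be computed.\<close>

locale pH_taylor =
  fixes Q P :: "real^'n^'n" and vc qc pc :: "nat \<Rightarrow> real^'n"
  assumes qc_Suc: "P *v pc i = real (Suc i) *\<^sub>R qc (Suc i)"
    and pc_Suc: "vc i - Q *v qc i = real (Suc i) *\<^sub>R pc (Suc i)"
begin

text \<open>Continuity gives order \<open>0\<close>, and integrating both differential equations
  raises the order of \<open>q\<close> and \<open>p\<close> together. This ends one order above that
  of the forcing \<open>v\<close>.\<close>

lemma trajectory_expands:
  assumes "0 < d" "expands N v vc" "q 0 = qc 0" "p 0 = pc 0"
    and q: "\<And>x. x \<in> {0..d} \<Longrightarrow> (q has_vector_derivative P *v p x) (at x within {0..d})"
    and p: "\<And>x. x \<in> {0..d} \<Longrightarrow> (p has_vector_derivative v x - Q *v q x) (at x within {0..d})"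
  shows "expands (Suc N) q qc" "expands (Suc N) p pc"
proof -
  have "expands n q qc \<and> expands n p pc" if "n \<le> Suc N" for n
    using that
  proof (induction n)
    case 0
    show ?case
      using continuous_on_vector_derivative[OF q] continuous_on_vector_derivative[OF p]
        expands_continuous[OF assms(1)] by blast
  next
    case (Suc n)
    then have IH: "expands n q qc" "expands n p pc" and v: "expands n v vc"
      using expands_mono[OF assms(2)] by auto
    have "expands (Suc n) q qc"
    proof (rule expands_cong[OF expands_integrate[OF assms(1) q expands_matrix[OF IH(2)]]])
      show "(case i of 0 \<Rightarrow> q 0 | Suc i \<Rightarrow> (P *v pc i) /\<^sub>R real (Suc i)) = qc i" for i
        using assms(3) by (cases i) (simp_all add: qc_Suc)
    qed auto
    moreover have "expands (Suc n) p pc"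
    proof (rule expands_cong[OF expands_integrate[OF assms(1) p
            expands_diff[OF v expands_matrix[OF IH(1)]]]])
      show "(case i of 0 \<Rightarrow> p 0 | Suc i \<Rightarrow> (vc i - Q *v qc i) /\<^sub>R real (Suc i)) = pc i" for i
        using assms(4) by (cases i) (simp_all add: pc_Suc)
    qed auto
    ultimately show ?case ..
  qed
  then show "expands (Suc N) q qc" "expands (Suc N) p pc" by auto
qed

text \<open>Expansions are recorded by factors relative to the exact coefficients. By
  \<open>qc_Suc\<close> the factor \<open>\<sigma> j\<close> of \<open>p\<close> reappears,
  multiplied by \<open>Suc j\<close>, at index \<open>Suc j\<close> of \<open>q\<close>; a factor
  \<open>1\<close> means agreement with the exact solution.\<close>

lemma expands_q_update:
  assumes "expands n g (\<lambda>i. \<sigma> i *\<^sub>R pc i)"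
  shows "expands (Suc n) (\<lambda>h. qc 0 + h *\<^sub>R (P *v g h))
    (\<lambda>i. (case i of 0 \<Rightarrow> 1 | Suc j \<Rightarrow> \<sigma> j * Suc j) *\<^sub>R qc i)"
  by (rule expands_cong[OF expands_add[OF expands_const expands_times_h[OF expands_matrix[OF assms]]]])
    (auto split: nat.split simp: matrix_vector_mult_scaleR qc_Suc)

text \<open>The common factor \<open>c ^ i\<close> of input and position lets \<open>pc_Suc\<close>
  collapse their difference to a single coefficient of \<open>p\<close>.\<close>

lemma expands_force:
  assumes "expands n w (\<lambda>i. c ^ i *\<^sub>R vc i)" "expands n x (\<lambda>i. c ^ i *\<^sub>R qc i)"
  shows "expands n (\<lambda>h. w h - Q *v x h) (\<lambda>i. (c ^ i * Suc i) *\<^sub>R pc (Suc i))"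
  by (rule expands_cong[OF expands_diff[OF assms(1) expands_matrix[OF assms(2)]]])
    (auto simp: matrix_vector_mult_scaleR pc_Suc simp flip: scaleR_diff_right scaleR_scaleR)

text \<open>Unlike in \<open>expands_q_update\<close>, the factor \<open>Suc i\<close> is already
  contained in \<open>\<sigma>\<close>, because \<open>expands_force\<close> puts it there.\<close>

lemma expands_p_update:
  assumes "expands n g (\<lambda>i. \<sigma> i *\<^sub>R pc (Suc i))"
  shows "expands (Suc n) (\<lambda>h. pc 0 + h *\<^sub>R g h) (\<lambda>i. (case i of 0 \<Rightarrow> 1 | Suc j \<Rightarrow> \<sigma> j) *\<^sub>R pc i)"
  by (rule expands_cong[OF expands_add[OF expands_const expands_times_h[OF assms]]])
    (auto split: nat.split)

end

section \<open>Relative Taylor factors and moments of the stages\<close>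

lemma expands_combination2:
  assumes "expands n f (\<lambda>i. \<alpha> i *\<^sub>R c i)" "expands n g (\<lambda>i. \<beta> i *\<^sub>R c i)"
  shows "expands n (\<lambda>h. x *\<^sub>R f h + y *\<^sub>R g h) (\<lambda>i. (x * \<alpha> i + y * \<beta> i) *\<^sub>R c i)"
  by (rule expands_cong[OF expands_add[OF assms[THEN expands_scaleR]]])
    (auto simp: scaleR_add_left)

lemma expands_combination3:
  assumes "expands n f (\<lambda>i. \<alpha> i *\<^sub>R c i)" "expands n g (\<lambda>i. \<beta> i *\<^sub>R c i)"
    "expands n k (\<lambda>i. \<gamma> i *\<^sub>R c i)"
  shows "expands n (\<lambda>h. x *\<^sub>R f h + y *\<^sub>R g h + z *\<^sub>R k h)
    (\<lambda>i. (x * \<alpha> i + y * \<beta> i + z * \<gamma> i) *\<^sub>R c i)"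
  by (rule expands_cong[OF expands_add[OF expands_add[OF assms(1,2)[THEN expands_scaleR]]
      assms(3)[THEN expands_scaleR]]])
    (auto simp: scaleR_add_left)

text \<open>Taylor coefficients of the internal stages of \<open>p\<close>, relative to those of the exact solution.\<close>

definition stage_factor :: "3 \<Rightarrow> nat \<Rightarrow> real" where
  "stage_factor i = case_nat 1 (\<lambda>j. (lobatto_IIIB $ i $ 1 * 0 ^ j + lobatto_IIIB $ i $ 2 * (1/2) ^ j) * Suc j)"

lemma gram_moments:
  assumes "a + b < 4"
  shows "(\<Sum>i\<in>UNIV. \<Sum>j\<in>UNIV. lagrange_gram $ i $ j * (stage_factor i a * lobatto_c $ j ^ b)) =
    1 / real (Suc (a + b))"
proof -
  have "(a = 0 \<or> a = 1 \<or> a = 2 \<or> a = 3) \<and> (b = 0 \<or> b = 1 \<or> b = 2 \<or> b = 3)"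
    using assms by auto
  then show ?thesis
    using assms
    by (elim conjE disjE)
      (simp_all add: sum_3 lagrange_gram_eq stage_factor_def lobatto_c_def lobatto_IIIB_def
        numeral_eq_Suc)
qed

text \<open>The stages are functions of the step size, so that they can be expanded in
  \<open>h\<close>; \<open>qc 0\<close> and \<open>pc 0\<close> double as the initial values of the
  step.\<close>

locale lobatto_run = pH_taylor Q P vc qc pc
  for Q P :: "real^'n^'n" and vc qc pc :: "nat \<Rightarrow> real^'n" +
  fixes G :: "real^'m^'n" and u :: "real \<Rightarrow> real^'m" and t0 :: real
    and qs ps :: "real \<Rightarrow> (real^'n)^3" and q4 p4 :: "real \<Rightarrow> real^'n"
  assumes step: "lobatto_step Q P G u t0 h (qc 0) (pc 0) (qs h) (ps h) (q4 h) (p4 h)"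
    and vc_0: "vc 0 = G *v u t0"
    and v_expands: "expands 4 (\<lambda>h. G *v u (t0 + h)) vc"
begin

definition force :: "3 \<Rightarrow> real \<Rightarrow> real^'n" where
  "force j h = G *v u (t0 + lobatto_c $ j * h) - Q *v qs h $ j"

text \<open>The zero first row of IIIA fixes the first \<open>q\<close> stage, its last row equals
  the weights, so the last \<open>q\<close> stage is the end value, and the zero last column of IIIB
  keeps \<open>force 3\<close> out of the \<open>p\<close> stages. Implicit coupling remains only
  between the second \<open>q\<close> stage and the \<open>p\<close> stages.\<close>

lemma stage_eqs:
  "qs h $ 1 = qc 0"
  "qs h $ 2 = qc 0 + h *\<^sub>R (P *v ((5/24) *\<^sub>R ps h $ 1 + (1/3) *\<^sub>R ps h $ 2 + (-1/24) *\<^sub>R ps h $ 3))"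
  "qs h $ 3 = qc 0 + h *\<^sub>R (P *v ((1/6) *\<^sub>R ps h $ 1 + (2/3) *\<^sub>R ps h $ 2 + (1/6) *\<^sub>R ps h $ 3))"
  "q4 h = qs h $ 3"
  "ps h $ i = pc 0 + h *\<^sub>R (lobatto_IIIB $ i $ 1 *\<^sub>R force 1 h + lobatto_IIIB $ i $ 2 *\<^sub>R force 2 h)"
  "p4 h = pc 0 + h *\<^sub>R ((1/6) *\<^sub>R force 1 h + (2/3) *\<^sub>R force 2 h + (1/6) *\<^sub>R force 3 h)"
proof -
  have q: "qs h $ i = qc 0 - h *\<^sub>R (\<Sum>j\<in>UNIV. lobatto_IIIA $ i $ j *\<^sub>R flow_q P (ps h) $ j)"
    and p: "ps h $ i = pc 0 - h *\<^sub>R (\<Sum>j\<in>UNIV. lobatto_IIIB $ i $ j *\<^sub>R flow_p Q G u t0 h (qs h) $ j)"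
    and q4: "q4 h = qc 0 - h *\<^sub>R (\<Sum>j\<in>UNIV. lobatto_b $ j *\<^sub>R flow_q P (ps h) $ j)"
    and p4: "p4 h = pc 0 - h *\<^sub>R (\<Sum>j\<in>UNIV. lobatto_b_hat $ j *\<^sub>R flow_p Q G u t0 h (qs h) $ j)"
    for i
    using step[of h] unfolding lobatto_step_def by blast+
  have fq: "flow_q P (ps h) $ j = - (P *v ps h $ j)"
    and fp: "flow_p Q G u t0 h (qs h) $ j = - force j h" for j
    by (simp_all add: flow_q_def effort_def flow_p_def force_def)
  note s = sum_3 fq fp matrix_vector_right_distrib matrix_vector_mult_scaleR algebra_simps
  show "qs h $ 1 = qc 0"
    "qs h $ 2 = qc 0 + h *\<^sub>R (P *v ((5/24) *\<^sub>R ps h $ 1 + (1/3) *\<^sub>R ps h $ 2 + (-1/24) *\<^sub>R ps h $ 3))"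
    "qs h $ 3 = qc 0 + h *\<^sub>R (P *v ((1/6) *\<^sub>R ps h $ 1 + (2/3) *\<^sub>R ps h $ 2 + (1/6) *\<^sub>R ps h $ 3))"
    by (subst q, simp add: s lobatto_IIIA_def)+
  show "q4 h = qs h $ 3"
    by (subst q4, subst q) (simp add: s lobatto_IIIA_def lobatto_b_def)
  show "ps h $ i = pc 0 + h *\<^sub>R (lobatto_IIIB $ i $ 1 *\<^sub>R force 1 h + lobatto_IIIB $ i $ 2 *\<^sub>R force 2 h)"
  proof -
    have "lobatto_IIIB $ i $ 3 = 0"
      using exhaust_3[of i] by (auto simp: lobatto_IIIB_def)
    then show ?thesis by (subst p) (simp add: s)
  qed
  show "p4 h = pc 0 + h *\<^sub>R ((1/6) *\<^sub>R force 1 h + (2/3) *\<^sub>R force 2 h + (1/6) *\<^sub>R force 3 h)"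
    by (subst p4) (simp add: s lobatto_b_hat_def)
qed

section \<open>Orders of the stages and of the end values\<close>

lemma v_stage_expands: "expands 4 (\<lambda>h. G *v u (t0 + lobatto_c $ j * h)) (\<lambda>i. lobatto_c $ j ^ i *\<^sub>R vc i)"
proof -
  have "lobatto_c $ j \<ge> 0"
    using exhaust_3[of j] by (auto simp: lobatto_c_def)
  then show ?thesis
    using expands_rescale[OF v_expands, of "lobatto_c $ j"] vc_0 by simp
qed

lemma force_expands:
  assumes "expands n (\<lambda>h. qs h $ j) (\<lambda>i. lobatto_c $ j ^ i *\<^sub>R qc i)" "n \<le> 4"
  shows "expands n (force j) (\<lambda>i. (lobatto_c $ j ^ i * Suc i) *\<^sub>R pc (Suc i))"
  unfolding force_def by (rule expands_force[OF expands_mono[OF v_stage_expands assms(2)] assms(1)])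

text \<open>At the node \<open>0\<close> the force is constantly \<open>pc 1\<close>, so the
  expansion holds to any order; \<open>0 ^ i\<close> vanishes for \<open>i > 0\<close>.\<close>

lemma force_1_expands: "expands n (force 1) (\<lambda>i. (0 ^ i * Suc i) *\<^sub>R pc (Suc i))"
  by (rule expands_cong[OF expands_const[of _ "pc 1"]])
    (auto simp: force_def lobatto_c_def stage_eqs(1) pc_Suc[of 0] power_0_left simp flip: vc_0)

lemma ps_expands:
  assumes "expands n (\<lambda>h. qs h $ 2) (\<lambda>i. (1/2) ^ i *\<^sub>R qc i)" "n \<le> 4"
  shows "expands (Suc n) (\<lambda>h. ps h $ i) (\<lambda>k. stage_factor i k *\<^sub>R pc k)"
proof -
  have 2: "expands n (force 2) (\<lambda>i. ((1/2) ^ i * Suc i) *\<^sub>R pc (Suc i))"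
    using force_expands[of n 2] assms by (simp add: lobatto_c_def)
  show ?thesis
    unfolding stage_eqs(5)
    by (rule expands_cong[OF expands_p_update[OF expands_combination2[OF force_1_expands 2]]])
      (auto simp: stage_factor_def algebra_simps split: nat.split)
qed

text \<open>Eliminating the \<open>p\<close> stages leaves a linear equation with operator I +
  (h^2/24) P Q and bounded right-hand side \<open>b\<close>, to which
  \<open>expands_0_perturbed\<close> applies.\<close>

lemma q2_bounded: "expands 0 (\<lambda>h. qs h $ 2) a"
proof -
  define w where "w h = G *v u (t0 + lobatto_c $ 2 * h)" for h
  define b where "b h = qc 0 + h *\<^sub>R ((1/2) *\<^sub>R (P *v pc 0) +
    h *\<^sub>R ((1/12) *\<^sub>R (P *v pc 1) + (1/24) *\<^sub>R (P *v w h)))" for h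
  have w: "expands 4 w (\<lambda>i. lobatto_c $ 2 ^ i *\<^sub>R vc i)"
    using v_stage_expands[of 2] unfolding w_def .
  have w0: "expands 0 w (\<lambda>i. lobatto_c $ 2 ^ i *\<^sub>R vc i)"
    by (rule expands_mono[OF w]) simp
  have "expands 0 (\<lambda>h. (1/12) *\<^sub>R (P *v pc 1) + (1/24) *\<^sub>R (P *v w h)) (\<lambda>_. 0)"
    using expands_add[OF expands_const expands_scaleR[OF expands_matrix[OF w0]]] expands_0_coeffs
    by blast
  then have b: "expands 0 b (\<lambda>_. 0)"
    using expands_add[OF expands_const expands_0_times_h[OF expands_add[OF expands_const expands_0_times_h]]]
      expands_0_coeffs
    unfolding b_def by blast
  have lin: "bounded_linear (\<lambda>x. (1/24) *\<^sub>R (P *v (Q *v x)))"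
    by (rule bounded_linear_compose[OF bounded_linear_scaleR_right
          bounded_linear_compose[OF matrix_vector_mul_bounded_linear matrix_vector_mul_bounded_linear]])
  have eq: "qs h $ 2 + h\<^sup>2 *\<^sub>R ((1/24) *\<^sub>R (P *v (Q *v qs h $ 2))) = b h" for h
  proof -
    have f: "force 1 h = pc 1" "force 2 h = w h - Q *v qs h $ 2"
      using pc_Suc[of 0] by (simp_all add: force_def w_def lobatto_c_def stage_eqs(1) flip: vc_0)
    \<comment> \<open>The second row of IIIA has sum 1/2, and its products with the first two
      columns of IIIB are 1/12 and 1/24.\<close>
    have comb: "(5/24) *\<^sub>R ps h $ 1 + (1/3) *\<^sub>R ps h $ 2 + (-1/24) *\<^sub>R ps h $ 3 =
        (1/2) *\<^sub>R pc 0 + h *\<^sub>R ((1/12) *\<^sub>R force 1 h + (1/24) *\<^sub>R force 2 h)"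
      by (simp add: stage_eqs(5) lobatto_IIIB_def vec_eq_iff field_simps)
    have "qs h $ 2 = qc 0 + h *\<^sub>R (P *v ((1/2) *\<^sub>R pc 0 +
        h *\<^sub>R ((1/12) *\<^sub>R pc 1 + (1/24) *\<^sub>R (w h - Q *v qs h $ 2))))"
      by (rule stage_eqs(2)[of h, unfolded comb f])
    also have "\<dots> = b h - h\<^sup>2 *\<^sub>R ((1/24) *\<^sub>R (P *v (Q *v qs h $ 2)))"
      by (simp add: b_def matrix_vector_right_distrib matrix_vector_mult_scaleR
          matrix_vector_mult_diff_distrib power2_eq_square algebra_simps)
    finally show ?thesis by (simp add: algebra_simps)
  qed
  show ?thesis
    by (rule expands_0_perturbed[OF lin expands_cong[OF b, where b = "\<lambda>_. 0"]]) (simp_all only: eq)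
qed

text \<open>One order is gained through the \<open>p\<close> stages and one through the
  \<open>q\<close> update. The factors agree with \<open>(1/2) ^ i\<close> up to
  \<open>i = 3\<close>; at \<open>i = 4\<close> the formula gives 1/8 instead of 1/16, hence the
  bound on \<open>n\<close>.\<close>

lemma q2_expands_step:
  assumes "expands n (\<lambda>h. qs h $ 2) (\<lambda>i. (1/2) ^ i *\<^sub>R qc i)" "n \<le> 2"
  shows "expands (Suc (Suc n)) (\<lambda>h. qs h $ 2) (\<lambda>i. (1/2) ^ i *\<^sub>R qc i)"
proof -
  have ps: "expands (Suc n) (\<lambda>h. ps h $ i) (\<lambda>k. stage_factor i k *\<^sub>R pc k)" for i
    using assms by (intro ps_expands) auto
  show ?thesis
    unfolding stage_eqs(2)[abs_def]
  proof (rule expands_cong[OF expands_q_update[OF expands_combination3[OF ps ps ps]]])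
    fix i assume "i < Suc (Suc n)"
    with assms(2) have "i = 0 \<or> i = 1 \<or> i = 2 \<or> i = 3" by auto
    then show "(case i of 0 \<Rightarrow> 1 | Suc j \<Rightarrow> (5/24 * stage_factor 1 j + 1/3 * stage_factor 2 j +
        -1/24 * stage_factor 3 j) * Suc j) *\<^sub>R qc i = (1/2) ^ i *\<^sub>R qc i"
      by (elim disjE) (simp_all add: stage_factor_def lobatto_IIIB_def numeral_eq_Suc)
  qed auto
qed

lemma q2_expands: "expands 4 (\<lambda>h. qs h $ 2) (\<lambda>i. (1/2) ^ i *\<^sub>R qc i)"
  using q2_expands_step[OF q2_expands_step[OF q2_bounded]] by (simp add: numeral_eq_Suc)

lemma stage_p_expands: "expands 5 (\<lambda>h. ps h $ i) (\<lambda>k. stage_factor i k *\<^sub>R pc k)"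
  using ps_expands[OF q2_expands] by simp

text \<open>Superconvergence: although the stage factors deviate from the powers of the nodes from
  index 2 on, the weights average them to 1 / (j + 1) for \<open>j \<le> 3\<close>, so the stage
  errors cancel.\<close>

lemma q4_expands: "expands 5 q4 qc"
proof -
  have ps: "expands 4 (\<lambda>h. ps h $ i) (\<lambda>k. stage_factor i k *\<^sub>R pc k)" for i
    by (rule expands_mono[OF stage_p_expands]) simp
  have "expands (Suc 4) (\<lambda>h. qs h $ 3) qc"
    unfolding stage_eqs(3)[abs_def]
  proof (rule expands_cong[OF expands_q_update[OF expands_combination3[OF ps ps ps]]])
    fix i :: nat assume "i < Suc 4"
    then have "i = 0 \<or> i = 1 \<or> i = 2 \<or> i = 3 \<or> i = 4" by auto
    then show "(case i of 0 \<Rightarrow> 1 | Suc j \<Rightarrow> (1/6 * stage_factor 1 j + 2/3 * stage_factor 2 j +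
        1/6 * stage_factor 3 j) * Suc j) *\<^sub>R qc i = qc i"
      by (elim disjE) (simp_all add: stage_factor_def lobatto_IIIB_def numeral_eq_Suc)
  qed auto
  then show ?thesis by (simp add: stage_eqs(4)[abs_def])
qed

text \<open>All three forces carry the exact factors to order four, and Simpson's rule is exact for
  cubics.\<close>

lemma p4_expands: "expands 5 p4 pc"
proof -
  have 2: "expands 4 (force 2) (\<lambda>i. ((1/2) ^ i * Suc i) *\<^sub>R pc (Suc i))"
    using force_expands[of 4 2] q2_expands by (simp add: lobatto_c_def)
  have "expands 4 (\<lambda>h. qs h $ 3) qc"
    using expands_mono[OF q4_expands, of 4] by (simp add: stage_eqs(4)[abs_def])
  then have 3: "expands 4 (force 3) (\<lambda>i. (1 ^ i * Suc i) *\<^sub>R pc (Suc i))"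
    using force_expands[of 4 3] by (simp add: lobatto_c_def)
  have "expands (Suc 4) p4 pc"
    unfolding stage_eqs(6)[abs_def]
  proof (rule expands_cong[OF expands_p_update[OF expands_combination3[OF force_1_expands 2 3]]])
    fix i :: nat assume "i < Suc 4"
    then have "i = 0 \<or> i = 1 \<or> i = 2 \<or> i = 3 \<or> i = 4" by auto
    then show "(case i of 0 \<Rightarrow> 1 | Suc j \<Rightarrow> 1/6 * (0 ^ j * Suc j) + 2/3 * ((1/2) ^ j * Suc j) +
        1/6 * (1 ^ j * Suc j)) *\<^sub>R pc i = pc i"
      by (elim disjE) (simp_all add: numeral_eq_Suc)
  qed auto
  then show ?thesis by simp
qed

end

section \<open>Energies\<close>

lemma stack_inner_kronecker_mat_1:
  fixes x y :: "(real^'a)^'b"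
  shows "stack x \<bullet> (kronecker A (mat 1) *v stack y) =
    (\<Sum>i\<in>UNIV. \<Sum>j\<in>UNIV. A $ i $ j * (x $ i \<bullet> y $ j))"
proof -
  have st: "stack z $ r = z $ fst r $ snd r" for z :: "(real^'a)^'b" and r
    by (simp add: stack_def)
  have "(kronecker A (mat 1) *v stack y) $ r = (\<Sum>j\<in>UNIV. A $ fst r $ j * y $ j $ snd r)" for r
  proof -
    have "(kronecker A (mat 1) *v stack y) $ r =
        (\<Sum>j\<in>UNIV. \<Sum>l\<in>UNIV. A $ fst r $ j * (if snd r = l then 1 else 0) * y $ j $ l)"
      by (simp add: matrix_vector_mult_def kronecker_def stack_def mat_def sum.cartesian_product
          case_prod_unfold flip: UNIV_Times_UNIV)
    then show ?thesis by (simp add: if_distrib if_distribR cong: if_cong)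
  qed
  then have "stack x \<bullet> (kronecker A (mat 1) *v stack y) =
      (\<Sum>i\<in>UNIV. \<Sum>k\<in>UNIV. x $ i $ k * (\<Sum>j\<in>UNIV. A $ i $ j * y $ j $ k))"
    by (simp add: inner_vec_def st sum.cartesian_product case_prod_unfold flip: UNIV_Times_UNIV)
  also have "\<dots> = (\<Sum>i\<in>UNIV. \<Sum>j\<in>UNIV. A $ i $ j * (x $ i \<bullet> y $ j))"
    unfolding inner_vec_def sum_distrib_left
    by (intro sum.cong refl, subst sum.swap) (simp add: mult_ac)
  finally show ?thesis .
qed

text \<open>The Gram matrix is symmetric, so the internal exchange of power between \<open>q\<close> and \<open>p\<close> cancels.\<close>

lemma supplied_energy_eq:
  "supplied_energy Q P G u t0 h qs ps =
    h * (\<Sum>i\<in>UNIV. \<Sum>j\<in>UNIV. lagrange_gram $ i $ j *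
      ((P *v ps $ i) \<bullet> (G *v u (t0 + lobatto_c $ j * h))))"
proof -
  let ?m = "\<lambda>x y. \<Sum>i\<in>UNIV. \<Sum>j\<in>UNIV. lagrange_gram $ i $ j * (x $ i \<bullet> y $ j)"
  have sym: "lagrange_gram $ i $ j = lagrange_gram $ j $ i" for i j
    by (simp add: lagrange_gram_def mult.commute)
  have swap: "?m x y = ?m y x" for x y :: "(real^'a)^3"
    by (subst sum.swap) (simp add: sym inner_commute)
  have "supplied_energy Q P G u t0 h qs ps =
      h * ?m (effort Q qs) (effort P ps) - h * ?m (effort P ps) (flow_p Q G u t0 h qs)"
    by (simp add: supplied_energy_def mass_matrix_def stack_inner_kronecker_mat_1 flow_q_def sum_negf)
  also have "\<dots> = h * (?m (effort P ps) (effort Q qs) - ?m (effort P ps) (flow_p Q G u t0 h qs))"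
    by (simp add: swap[of "effort Q qs"] right_diff_distrib)
  also have "\<dots> = h * ?m (effort P ps) (\<chi> j. G *v u (t0 + lobatto_c $ j * h))"
    by (simp add: flow_p_def inner_diff_right right_diff_distrib flip: sum_subtractf)
  finally show ?thesis by (simp add: effort_def)
qed

section \<open>Power balance and expansion of the Hamiltonian\<close>

lemma sym_pos_def_inner_commute:
  assumes "sym_pos_def A"
  shows "x \<bullet> (A *v y) = (A *v x) \<bullet> y"
  using assms unfolding sym_pos_def_def by (metis dot_lmul_matrix vector_transpose_matrix)

lemma has_vector_derivative_quadratic_form:
  fixes x :: "real \<Rightarrow> real^'n"
  assumes "sym_pos_def A" "(x has_vector_derivative x') (at t within S)"
  shows "((\<lambda>t. 1/2 * (x t \<bullet> (A *v x t))) has_vector_derivative (A *v x t) \<bullet> x') (at t within S)"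
proof -
  have "((\<lambda>t. x t \<bullet> (A *v x t)) has_vector_derivative x t \<bullet> (A *v x') + x' \<bullet> (A *v x t)) (at t within S)"
    by (intro bounded_bilinear.has_vector_derivative[OF bounded_bilinear_inner]
        bounded_linear.has_vector_derivative[OF matrix_vector_mul_bounded_linear] assms(2))
  also have "x t \<bullet> (A *v x') + x' \<bullet> (A *v x t) = 2 * ((A *v x t) \<bullet> x')"
    using sym_pos_def_inner_commute[OF assms(1)] by (simp add: inner_commute)
  finally show ?thesis
    using bounded_linear.has_vector_derivative[OF bounded_linear_mult_right[of "1/2"]] by fastforce
qed

text \<open>The terms \<open>(Q *v q t) \<bullet> (P *v p t)\<close> from the two quadratic forms
  cancel, leaving the power supplied by the input.\<close>

lemma has_vector_derivative_hamiltonian: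
  fixes q p v :: "real \<Rightarrow> real^'n"
  assumes "sym_pos_def Q" "sym_pos_def P"
    and "(q has_vector_derivative P *v p t) (at t within S)"
    and "(p has_vector_derivative v t - Q *v q t) (at t within S)"
  shows "((\<lambda>t. hamiltonian Q P (q t) (p t)) has_vector_derivative (P *v p t) \<bullet> v t) (at t within S)"
  using has_vector_derivative_add[OF has_vector_derivative_quadratic_form[OF assms(1,3)]
      has_vector_derivative_quadratic_form[OF assms(2,4)]]
  unfolding hamiltonian_def by (simp add: inner_diff_right inner_commute)

lemma expands_hamiltonian:
  assumes "expands n q a" "expands n p b"
  shows "expands n (\<lambda>h. hamiltonian Q P (q h) (p h))
    (\<lambda>k. 1/2 * (\<Sum>i\<le>k. a i \<bullet> (Q *v a (k - i))) + 1/2 * (\<Sum>i\<le>k. b i \<bullet> (P *v b (k - i))))"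
  unfolding hamiltonian_def
  by (intro expands_add expands_cmult expands_inner expands_matrix assms)

lemma expands_same_bound:
  fixes f g :: "real \<Rightarrow> real"
  assumes "expands n f a" "expands n g a"
  obtains C where "C > 0" "\<forall>\<^sub>F h in at_right 0. \<bar>f h - g h\<bar> \<le> C * h ^ n"
  using expandsE[OF expands_diff[OF assms]] by auto

section \<open>Comparison of the energies on one step\<close>

context lobatto_run
begin

text \<open>These are the coefficients of the integral of \<open>P p \<bullet> v\<close> over the
  step, obtained from the Cauchy products of the stages by \<open>gram_moments\<close>.\<close>

lemma supplied_energy_expands:
  "expands 5 (\<lambda>h. supplied_energy Q P G u t0 h (qs h) (ps h))
    (case_nat 0 (\<lambda>k. (\<Sum>a\<le>k. (P *v pc a) \<bullet> vc (k - a)) /\<^sub>R real (Suc k)))"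
proof -
  let ?c = "\<lambda>i j k. \<Sum>a\<le>k. (P *v (stage_factor i a *\<^sub>R pc a)) \<bullet> (lobatto_c $ j ^ (k - a) *\<^sub>R vc (k - a))"
  have ps: "expands 4 (\<lambda>h. ps h $ i) (\<lambda>k. stage_factor i k *\<^sub>R pc k)" for i
    by (rule expands_mono[OF stage_p_expands]) simp
  have "expands (Suc 4) (\<lambda>h. h *\<^sub>R (\<Sum>i\<in>UNIV. \<Sum>j\<in>UNIV. lagrange_gram $ i $ j *
      ((P *v ps h $ i) \<bullet> (G *v u (t0 + lobatto_c $ j * h)))))
    (case_nat 0 (\<lambda>k. \<Sum>i\<in>UNIV. \<Sum>j\<in>UNIV. lagrange_gram $ i $ j * ?c i j k))"
    by (intro expands_times_h expands_sum expands_cmult expands_inner expands_matrix ps v_stage_expands)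
  then have "expands 5 (\<lambda>h. supplied_energy Q P G u t0 h (qs h) (ps h))
    (case_nat 0 (\<lambda>k. \<Sum>i\<in>UNIV. \<Sum>j\<in>UNIV. lagrange_gram $ i $ j * ?c i j k))"
    by (simp add: supplied_energy_eq)
  then show ?thesis
  proof (rule expands_cong)
    fix k :: nat assume "k < 5"
    have "(\<Sum>i\<in>UNIV. \<Sum>j\<in>UNIV. lagrange_gram $ i $ j * ?c i j k) =
        (\<Sum>a\<le>k. (P *v pc a) \<bullet> vc (k - a)) /\<^sub>R real (Suc k)" if "k < 4" for k
    proof -
      \<comment> \<open>With the sum over \<open>a\<close> outermost, the moment with exponents
        \<open>a\<close> and \<open>k - a\<close> splits off; they add up to
        \<open>k < 4\<close>.\<close>
      have "(\<Sum>i\<in>UNIV. \<Sum>j\<in>UNIV. lagrange_gram $ i $ j * ?c i j k) =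
          (\<Sum>a\<le>k. (\<Sum>i\<in>UNIV. \<Sum>j\<in>UNIV. lagrange_gram $ i $ j *
            (stage_factor i a * lobatto_c $ j ^ (k - a))) * ((P *v pc a) \<bullet> vc (k - a)))"
        unfolding sum_distrib_left sum_distrib_right sum.swap[where B = "{..k}"]
        by (simp add: matrix_vector_mult_scaleR mult_ac)
      also have "\<dots> = (\<Sum>a\<le>k. 1 / real (Suc k) * ((P *v pc a) \<bullet> vc (k - a)))"
        using that by (intro sum.cong refl) (simp add: gram_moments del: of_nat_Suc)
      finally show ?thesis by (simp add: sum_distrib_left divide_inverse del: of_nat_Suc)
    qed
    then show "(case k of 0 \<Rightarrow> 0 | Suc k \<Rightarrow> \<Sum>i\<in>UNIV. \<Sum>j\<in>UNIV. lagrange_gram $ i $ j * ?c i j k) =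
        (case k of 0 \<Rightarrow> 0 | Suc k \<Rightarrow> (\<Sum>a\<le>k. (P *v pc a) \<bullet> vc (k - a)) /\<^sub>R real (Suc k))"
      using \<open>k < 5\<close> by (auto split: nat.split simp del: of_nat_Suc)
  qed simp
qed

lemma energy_errors:
  fixes q p :: "real \<Rightarrow> real^'n"
  assumes "sym_pos_def Q" "sym_pos_def P" "0 < d" "q 0 = qc 0" "p 0 = pc 0"
    and q: "\<And>x. x \<in> {0..d} \<Longrightarrow> (q has_vector_derivative P *v p x) (at x within {0..d})"
    and p: "\<And>x. x \<in> {0..d} \<Longrightarrow>
      (p has_vector_derivative G *v u (t0 + x) - Q *v q x) (at x within {0..d})"
  shows "\<exists>C>0. \<forall>\<^sub>F h in at_right 0.
    \<bar>supplied_energy Q P G u t0 h (qs h) (ps h) - energy_increment Q P (qc 0) (pc 0) (q4 h) (p4 h)\<bar>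
      \<le> C * h ^ 5 \<and>
    \<bar>supplied_energy Q P G u t0 h (qs h) (ps h) - energy_increment Q P (qc 0) (pc 0) (q h) (p h)\<bar>
      \<le> C * h ^ 5"
proof -
  let ?H = "\<lambda>h. hamiltonian Q P (q h) (p h)"
  have qp: "expands 5 q qc" "expands 5 p pc"
    using trajectory_expands[OF assms(3) v_expands assms(4,5) q p] by simp_all
  let ?c = "\<lambda>k. (\<Sum>a\<le>k. (P *v pc a) \<bullet> vc (k - a)) /\<^sub>R real (Suc k)"
  have "expands 4 (\<lambda>h. (P *v p h) \<bullet> (G *v u (t0 + h))) (\<lambda>k. \<Sum>a\<le>k. (P *v pc a) \<bullet> vc (k - a))"
    by (intro expands_inner expands_matrix v_expands expands_mono[OF qp(2)]) simp
  \<comment> \<open>Integrating the power balance gives the exact energy the same coefficients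
    \<open>?c\<close> as the supplied energy.\<close>
  from expands_integrate[OF assms(3) has_vector_derivative_hamiltonian[where v = "\<lambda>x. G *v u (t0 + x)", OF assms(1,2) q p] this]
  have H: "expands 5 ?H (case_nat (?H 0) ?c)" by simp
  have "expands 5 (\<lambda>h. energy_increment Q P (qc 0) (pc 0) (q h) (p h)) (case_nat 0 ?c)"
    unfolding energy_increment_def
    by (rule expands_cong[OF expands_diff[OF H expands_const]])
      (auto split: nat.split simp: assms(4,5))
  from expands_same_bound[OF supplied_energy_expands this]
  obtain C where C: "C > 0" "\<forall>\<^sub>F h in at_right 0.
      \<bar>supplied_energy Q P G u t0 h (qs h) (ps h) - energy_increment Q P (qc 0) (pc 0) (q h) (p h)\<bar> \<le> C * h ^ 5"
    by blast
  \<comment> \<open>The exact and the numerical end values share the coefficients \<open>qc\<close>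
    and \<open>pc\<close>, hence so do their Hamiltonians. The two bounds combine by the triangle
    inequality.\<close>
  from expands_same_bound[OF expands_hamiltonian[OF qp] expands_hamiltonian[OF q4_expands p4_expands]]
  obtain D where D: "D > 0" "\<forall>\<^sub>F h in at_right 0. \<bar>?H h - hamiltonian Q P (q4 h) (p4 h)\<bar> \<le> D * h ^ 5"
    by blast
  show ?thesis
  proof (intro exI[of _ "C + D"] conjI)
    show "\<forall>\<^sub>F h in at_right 0.
      \<bar>supplied_energy Q P G u t0 h (qs h) (ps h) - energy_increment Q P (qc 0) (pc 0) (q4 h) (p4 h)\<bar>
        \<le> (C + D) * h ^ 5 \<and>
      \<bar>supplied_energy Q P G u t0 h (qs h) (ps h) - energy_increment Q P (qc 0) (pc 0) (q h) (p h)\<bar>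
        \<le> (C + D) * h ^ 5"
      using C(2) D(2) unfolding energy_increment_def
      by eventually_elim (unfold distrib_right, linarith)
  qed (use C D in simp)
qed

end

section \<open>Instantiation for a given trajectory and input\<close>

theorem theorem4:
  fixes Q P :: "real^'n^'n" and G :: "real^'m^'n"
    and u y :: "real \<Rightarrow> real^'m" and q p :: "real \<Rightarrow> real^'n" and t0 T :: real
  assumes "sym_pos_def Q" and "sym_pos_def P"
    and "t0 < T"
    and "Ck_on 4 u {t0..T}"
    and "pH_trajectory Q P G {t0..T} u q p y"
  shows "\<exists>C>0. \<forall>\<^sub>F h in at_right 0. \<forall>qs ps q4 p4.
    lobatto_step Q P G u t0 h (q t0) (p t0) qs ps q4 p4 \<longrightarrow>
      \<bar>supplied_energy Q P G u t0 h qs ps - energy_increment Q P (q t0) (p t0) q4 p4\<bar> \<le> C * h ^ 5 \<and>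
      \<bar>supplied_energy Q P G u t0 h qs ps
        - energy_increment Q P (q t0) (p t0) (q (t0 + h)) (p (t0 + h))\<bar> \<le> C * h ^ 5"
proof -
  \<comment> \<open>Four derivatives of \<open>u\<close> give the input to order four; the factor
    \<open>h\<close> in the supplied energy makes this order five.\<close>
  obtain uc where uc: "uc 0 = u t0" "expands 4 (\<lambda>h. u (t0 + h)) uc"
    using expands_Ck_on[OF assms(3,4)] .
  define vc where "vc i = G *v uc i" for i
  \<comment> \<open>The two coefficient sequences depend on each other, so one recursion on pairs
    builds both; its equations are the assumptions of \<open>pH_taylor\<close>.\<close>
  define z where "z = rec_nat (q t0, p t0)
    (\<lambda>i (x, y). ((P *v y) /\<^sub>R real (Suc i), (vc i - Q *v x) /\<^sub>R real (Suc i)))"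
  define qc where "qc i = fst (z i)" for i
  define pc where "pc i = snd (z i)" for i
  have init: "qc 0 = q t0" "pc 0 = p t0"
    by (simp_all add: qc_def pc_def z_def)
  let ?S = "\<lambda>h (qs, ps, q4, p4). lobatto_step Q P G u t0 h (q t0) (p t0) qs ps q4 p4"
  \<comment> \<open>Choosing the unique solution turns the stages into functions of
    \<open>h\<close>; uniqueness carries the bound over to every solution of the stage
    equations.\<close>
  define w where "w h = (THE z. ?S h z)" for h
  have w: "?S h (w h)" for h
    unfolding w_def by (rule theI'[OF lobatto_step_ex1[OF assms(1,2)]])
  have unique: "w h = (qs, ps, q4, p4)" if "lobatto_step Q P G u t0 h (q t0) (p t0) qs ps q4 p4"
    for h qs ps q4 p4
    unfolding w_def using that by (intro the1_equality[OF lobatto_step_ex1[OF assms(1,2)]]) simp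
  define qs where "qs h = fst (w h)" for h
  define ps where "ps h = fst (snd (w h))" for h
  define q4 where "q4 h = fst (snd (snd (w h)))" for h
  define p4 where "p4 h = snd (snd (snd (w h)))" for h
  interpret lobatto_run Q P vc qc pc G u t0 qs ps q4 p4
  proof unfold_locales
    show "expands 4 (\<lambda>h. G *v u (t0 + h)) vc"
      unfolding vc_def by (rule expands_matrix[OF uc(2)])
    show "lobatto_step Q P G u t0 h (qc 0) (pc 0) (qs h) (ps h) (q4 h) (p4 h)" for h
      using w[of h] by (simp add: init qs_def ps_def q4_def p4_def case_prod_unfold)
  qed (simp_all add: qc_def pc_def z_def case_prod_unfold vc_def uc(1) del: of_nat_Suc)
  have traj: "(q has_vector_derivative P *v p t) (at t within {t0..T})"
    "(p has_vector_derivative G *v u t - Q *v q t) (at t within {t0..T})" if "t \<in> {t0..T}" for t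
    using assms(5) that unfolding pH_trajectory_def by (simp_all add: add.commute)
  have "\<exists>C>0. \<forall>\<^sub>F h in at_right 0.
    \<bar>supplied_energy Q P G u t0 h (qs h) (ps h) - energy_increment Q P (qc 0) (pc 0) (q4 h) (p4 h)\<bar>
      \<le> C * h ^ 5 \<and>
    \<bar>supplied_energy Q P G u t0 h (qs h) (ps h)
      - energy_increment Q P (qc 0) (pc 0) (q (t0 + h)) (p (t0 + h))\<bar> \<le> C * h ^ 5"
    using assms(3)
    by (intro energy_errors[OF assms(1,2), where d = "T - t0"] has_vector_derivative_translate traj)
      (auto simp: init)
  moreover have "qs' = qs h \<and> ps' = ps h \<and> q4' = q4 h \<and> p4' = p4 h"
    if "lobatto_step Q P G u t0 h (q t0) (p t0) qs' ps' q4' p4'" for h qs' ps' q4' p4'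
    using unique[OF that] by (simp add: qs_def ps_def q4_def p4_def)
  ultimately show ?thesis
    unfolding init by (elim exE conjE) (intro exI conjI, assumption, erule eventually_mono, blast)
qed

end
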